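(* Let $X$ be a normed space, let $\{x_t\}_{t\in\mathbb{N}}$ be a sequence in $X$, let $\mathcal{I}$ be a non-trivial ideal on $\mathbb{N}$, and let $r\ge0$. If the weighted sequence $\{\omega_t\}_{t\in\mathbb{N}}$ is $\mathcal{I}$-bounded, then $(\omega_t,\mathcal{I})\text{-}\Gamma_{x_t}^r$ is a closed subset of $X$.
   Context: A sequence $\{\omega_t\}_{t\in\mathbb{N}}$ of real numbers is a weighted sequence if there is $\beta>0$ with $\omega_t>\beta$ for all $t\in\mathbb{N}$. An ideal on $\mathbb{N}$ is a family $\mathcal{I}\subseteq\mathcal{P}(\mathbb{N})$ with $\varnothing\in\mathcal{I}$, closed under finite unions and under taking subsets; it is non-trivial if $\mathbb{N}\notin\mathcal{I}$. A weighted sequence $\{\omega_t\}$ is $\mathcal{I}$-bounded if there is $\mu>0$ with $\{t\in\mathbb{N}:\omega_t>\mu\}\in\mathcal{I}$. For a non-trivial ideal $\mathcal{I}$ and $r\ge0$, the rough weighted ideal cluster points set $(\omega_t,\mathcal{I})\text{-}\Gamma_{x_t}^r$ is the set of all $\gamma\in X$ such that $\{t\in\mathbb{N}:\omega_t\|x_t-\gamma\|<r+\varepsilon\}\notin\mathcal{I}$ for every $\varepsilon>0$. *)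

theory Defs
  imports "HOL-Analysis.Analysis"
begin

definition weighted_seq :: "(nat \<Rightarrow> real) \<Rightarrow> bool" where
  "weighted_seq \<omega> \<longleftrightarrow> (\<exists>\<beta>>0. \<forall>t. \<omega> t > \<beta>)"

definition set_ideal :: "nat set set \<Rightarrow> bool" where
  "set_ideal I \<longleftrightarrow>
     {} \<in> I \<and>
     (\<forall>A\<in>I. \<forall>B\<in>I. A \<union> B \<in> I) \<and>
     (\<forall>A\<in>I. \<forall>B. B \<subseteq> A \<longrightarrow> B \<in> I)"

definition nontrivial_ideal :: "nat set set \<Rightarrow> bool" where
  "nontrivial_ideal I \<longleftrightarrow> set_ideal I \<and> UNIV \<notin> I"

definition ideal_bounded :: "nat set set \<Rightarrow> (nat \<Rightarrow> real) \<Rightarrow> bool" where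
  "ideal_bounded I \<omega> \<longleftrightarrow> (\<exists>\<mu>>0. {t. \<omega> t > \<mu>} \<in> I)"

definition rough_weighted_cluster_points ::
  "(nat \<Rightarrow> real) \<Rightarrow> nat set set \<Rightarrow> real \<Rightarrow> (nat \<Rightarrow> 'a::real_normed_vector) \<Rightarrow> 'a set" where
  "rough_weighted_cluster_points \<omega> I r x =
     {\<gamma>. \<forall>\<epsilon>>0. {t. \<omega> t * norm (x t - \<gamma>) < r + \<epsilon>} \<notin> I}"

end

theory Submission
  imports Defs
begin

text \<open>
  Moving the centre from a cluster point \<open>\<delta>\<close> to a nearby point \<open>\<gamma>\<close> changes the weighted distance
  \<open>\<omega> t * norm (x t - \<gamma>)\<close> by at most \<open>\<omega> t * dist \<delta> \<gamma>\<close>.  Outside a set of the ideal the weights are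
  bounded by a constant \<open>\<mu>\<close>, so there the change is below \<open>\<epsilon> / 2\<close> as soon as \<open>dist \<delta> \<gamma> < \<epsilon> / (2 * \<mu>)\<close>,
  uniformly in \<open>t\<close>.  The indices where the bound fails form a set of the ideal and cannot turn the
  large set of indices belonging to \<open>\<delta>\<close> into a small one.  Hence a limit of cluster points is a
  cluster point.
\<close>

theorem proposition4p5:
  fixes x :: "nat \<Rightarrow> 'a::real_normed_vector"
    and \<omega> :: "nat \<Rightarrow> real"
    and I :: "nat set set"
    and r :: real
  assumes "nontrivial_ideal I"
    and "r \<ge> 0"
    and "weighted_seq \<omega>"
    and "ideal_bounded I \<omega>"
  shows "closed (rough_weighted_cluster_points \<omega> I r x)"
proof -
  let ?\<Gamma> = "rough_weighted_cluster_points \<omega> I r x"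
  have union: "\<And>A B. A \<in> I \<Longrightarrow> B \<in> I \<Longrightarrow> A \<union> B \<in> I"
    and subset: "\<And>A B. A \<in> I \<Longrightarrow> B \<subseteq> A \<Longrightarrow> B \<in> I"
    using assms(1) unfolding nontrivial_ideal_def set_ideal_def by blast+
  have pos: "\<omega> t > 0" for t
    using assms(3) unfolding weighted_seq_def by (meson less_trans)
  obtain \<mu> where "\<mu> > 0" and large_weights: "{t. \<omega> t > \<mu>} \<in> I"
    using assms(4) unfolding ideal_bounded_def by blast
  have "\<gamma> \<in> ?\<Gamma>" if "\<gamma> \<in> closure ?\<Gamma>" for \<gamma>
    unfolding rough_weighted_cluster_points_def
  proof (intro CollectI allI impI notI)
    fix \<epsilon> :: real
    assume "\<epsilon> > 0" and small: "{t. \<omega> t * norm (x t - \<gamma>) < r + \<epsilon>} \<in> I"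
    have "\<epsilon> / (2 * \<mu>) > 0"
      using \<open>\<epsilon> > 0\<close> \<open>\<mu> > 0\<close> by simp
    then obtain \<delta> where "\<delta> \<in> ?\<Gamma>" and "dist \<delta> \<gamma> < \<epsilon> / (2 * \<mu>)"
      using \<open>\<gamma> \<in> closure ?\<Gamma>\<close> unfolding closure_approachable by blast
    then have close: "\<mu> * norm (\<delta> - \<gamma>) < \<epsilon> / 2"
      using \<open>\<mu> > 0\<close> by (simp add: dist_norm field_simps)
    have "\<omega> t * norm (x t - \<gamma>) < r + \<epsilon>"
      if "\<omega> t * norm (x t - \<delta>) < r + \<epsilon> / 2" and "\<omega> t \<le> \<mu>" for t
    proof -
      have "norm (x t - \<gamma>) \<le> norm (x t - \<delta>) + norm (\<delta> - \<gamma>)"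
        using norm_triangle_ineq[of "x t - \<delta>" "\<delta> - \<gamma>"] by simp
      then have "\<omega> t * norm (x t - \<gamma>) \<le> \<omega> t * norm (x t - \<delta>) + \<omega> t * norm (\<delta> - \<gamma>)"
        using pos[of t] by (metis distrib_left less_imp_le mult_left_mono)
      also have "\<omega> t * norm (\<delta> - \<gamma>) \<le> \<mu> * norm (\<delta> - \<gamma>)"
        using that(2) by (simp add: mult_right_mono)
      finally show ?thesis
        using that(1) close by linarith
    qed
    then have "{t. \<omega> t * norm (x t - \<delta>) < r + \<epsilon> / 2}
        \<subseteq> {t. \<omega> t * norm (x t - \<gamma>) < r + \<epsilon>} \<union> {t. \<omega> t > \<mu>}"
      by force
    then have "{t. \<omega> t * norm (x t - \<delta>) < r + \<epsilon> / 2} \<in> I"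
      using subset union small large_weights by blast
    moreover have "\<epsilon> / 2 > 0"
      using \<open>\<epsilon> > 0\<close> by simp
    ultimately show False
      using \<open>\<delta> \<in> ?\<Gamma>\<close> unfolding rough_weighted_cluster_points_def by blast
  qed
  then show ?thesis
    using closure_subset_eq by blast
qed

end
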